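(* Assume the state set $S$ is nonempty. Let $(\gamma,x_0)$ and $(\delta,y_0)$ be based, reachable cellular automata, with $\gamma\colon X\to CX$ and $\delta\colon Y\to CY$, and suppose that the action of $\gamma$ is free, i.e. $\gamma_1(x)\colon M\to X$ is injective for every $x\in X$. Let $t\colon X^*\to Y^*$ be a logical transport $(\gamma,x_0)\rightsquigarrow(\delta,y_0)$. Then there exists a unique based cellular morphism $(\gamma,x_0)\to(\delta,y_0)$ whose second component is $t$; that is, there is a unique based pre-cellular morphism $f\colon(\gamma,x_0)\to(\delta,y_0)$ such that $(f,t)$ is a cellular morphism, i.e. such that $t(c)\circ f=c$ for all $c\in X^*$.
   Context: Fix a monoid $(M,\cdot,e)$, a subset $N\subseteq M$ (the neighbourhood) with inclusion $i\colon N\hookrightarrow M$, and a set $S$ of states. $[A,B]$ denotes the set of all maps $A\to B$. For a map $a\colon M\to X$ let $I^a\subseteq[N,S]$ be the set of maps $f\colon N\to S$ such that $f(n)=f(n')$ whenever $n,n'\in N$ satisfy $a(i(n))=a(i(n'))$; for $h\colon X\to Y$ one has $I^{h\circ a}\subseteq I^a$. Let $C$ be the endofunctor on sets with $CX=\coprod_{a\colon M\to X}[I^a,S]$ and $(Ch)(a,f)=(h\circ a,\ f|_{I^{h\circ a}})$. A cellular automaton is a map $\gamma\colon X\to CX$, written $\gamma(x)=(\gamma_1(x),\gamma_2(x))$ with $\gamma_1(x)\colon M\to X$, $\gamma_2(x)\colon I^{\gamma_1(x)}\to S$, such that $\gamma_1(x)(e)=x$ and $\gamma_1(\gamma_1(x)(m))(n)=\gamma_1(x)(n\cdot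 m)$ for all $x\in X$, $m,n\in M$. A pre-cellular morphism $h\colon\gamma\to\delta$ (with $\delta\colon Y\to CY$ a cellular automaton) is a map $h\colon X\to Y$ with $Ch\circ\gamma=\delta\circ h$, i.e. $h(\gamma_1(x)(m))=\delta_1(h(x))(m)$ and $\delta_2(h(x))(f)=\gamma_2(x)(f)$ for all $f\in I^{\delta_1(h(x))}$. A configuration of $\gamma$ is a map $c\colon X\to S$; write $X^*=[X,S]$, and for $h\colon X\to Y$ let $h^*\colon Y^*\to X^*$, $h^*(c)=c\circ h$. The global rule $G_\gamma\colon X^*\to X^*$ is $G_\gamma(c)(x)=\gamma_2(x)(c\circ\gamma_1(x)\circ i)$. A cellular morphism $\gamma\to\delta$ is a pair $(f,s)$ with $f$ a pre-cellular morphism and $s\colon X^*\to Y^*$ with $f^*\circ s=\mathrm{id}$. A based cellular automaton is a pair $(\gamma,x_0)$ with $x_0\in X$; it is reachable if $\gamma_1(x_0)\colon M\to X$ is surjective; a (pre-)cellular morphism $(f,s)$ or $f$ is based $(\gamma,x_0)\to(\delta,y_0)$ if $f(x_0)=y_0$. Modal formulas are generated by $\varphi::=s\mid\neg\varphi\mid\bigvee_{j\in J}\varphi_j\mid\langle m\rangle\varphi\mid\bigcirc\varphi$ with $s\in S$, $m\in M$, $J$ an arbitrary index set. For a cellular automaton $\gamma\colon X\to CX$, $x\in X$, $c\in X^*$: $(\gamma,x,c)\models s$ iff $c(x)=s$; $\neg$ and $\bigvee$ are interpreted classically; $(\gamma,x,c)\models\langle m\rangle\varphi$ iff $(\gamma,\gamma_1(x)(m),c)\models\varphi$;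 $(\gamma,x,c)\models\bigcirc\varphi$ iff $(\gamma,x,G_\gamma(c))\models\varphi$. A logical transport $(\gamma,x_0)\rightsquigarrow(\delta,y_0)$ is a map $t\colon X^*\to Y^*$ such that for all formulas $\varphi$ and all $c\in X^*$: $(\gamma,x_0,c)\models\varphi$ iff $(\delta,y_0,t(c))\models\varphi$. *)

theory Defs
  imports Main "HOL-Library.FuncSet"
begin

text \<open>
  The monoid is a type of class \<open>monoid_mult\<close>, and the state set and the cell sets are types
  \<open>'s\<close>, \<open>'x\<close>, \<open>'y\<close>; so the state set is automatically nonempty.
  The neighbourhood \<open>N\<close> is an arbitrary, possibly empty, set of monoid elements.
  Maps out of a set that is not a whole type are functions that are \<^const>\<open>undefined\<close> outside of
  it (\<open>\<rightarrow>\<^sub>E\<close>), so equality of such maps is equality of HOL functions; precomposition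
  with the inclusion of a subset is \<^const>\<open>restrict\<close>.
\<close>

definition patterns :: "'m set \<Rightarrow> ('m \<Rightarrow> 'x) \<Rightarrow> ('m \<Rightarrow> 's) set" where
  "patterns N a = {f \<in> N \<rightarrow>\<^sub>E UNIV. \<forall>n\<in>N. \<forall>n'\<in>N. a n = a n' \<longrightarrow> f n = f n'}"

definition C_obj :: "'m set \<Rightarrow> (('m \<Rightarrow> 'x) \<times> (('m \<Rightarrow> 's) \<Rightarrow> 's)) set" where
  "C_obj N = (SIGMA a:UNIV. patterns N a \<rightarrow>\<^sub>E UNIV)"

definition C_map ::
  "'m set \<Rightarrow> ('x \<Rightarrow> 'y) \<Rightarrow> ('m \<Rightarrow> 'x) \<times> (('m \<Rightarrow> 's) \<Rightarrow> 's) \<Rightarrow> ('m \<Rightarrow> 'y) \<times> (('m \<Rightarrow> 's) \<Rightarrow> 's)"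
where
  "C_map N h = (\<lambda>(a, f). (h \<circ> a, restrict f (patterns N (h \<circ> a))))"

type_synonym ('m, 's, 'x) coalg = "'x \<Rightarrow> ('m \<Rightarrow> 'x) \<times> (('m \<Rightarrow> 's) \<Rightarrow> 's)"

definition action :: "('m, 's, 'x) coalg \<Rightarrow> 'x \<Rightarrow> 'm \<Rightarrow> 'x" where
  "action \<gamma> x = fst (\<gamma> x)"

definition local_rule :: "('m, 's, 'x) coalg \<Rightarrow> 'x \<Rightarrow> ('m \<Rightarrow> 's) \<Rightarrow> 's" where
  "local_rule \<gamma> x = snd (\<gamma> x)"

definition cellular_automaton :: "'m::monoid_mult set \<Rightarrow> ('m, 's, 'x) coalg \<Rightarrow> bool" where
  "cellular_automaton N \<gamma> \<longleftrightarrow>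
     (\<forall>x. \<gamma> x \<in> C_obj N) \<and>
     (\<forall>x. action \<gamma> x 1 = x) \<and>
     (\<forall>x m n. action \<gamma> (action \<gamma> x m) n = action \<gamma> x (n * m))"

definition reachable :: "('m, 's, 'x) coalg \<Rightarrow> 'x \<Rightarrow> bool" where
  "reachable \<gamma> x\<^sub>0 \<longleftrightarrow> surj (action \<gamma> x\<^sub>0)"

definition free_action :: "('m, 's, 'x) coalg \<Rightarrow> bool" where
  "free_action \<gamma> \<longleftrightarrow> (\<forall>x. inj (action \<gamma> x))"

definition global_rule :: "'m set \<Rightarrow> ('m, 's, 'x) coalg \<Rightarrow> ('x \<Rightarrow> 's) \<Rightarrow> ('x \<Rightarrow> 's)" where
  "global_rule N \<gamma> c x = local_rule \<gamma> x (restrict (c \<circ> action \<gamma> x) N)"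

definition pullback :: "('x \<Rightarrow> 'y) \<Rightarrow> ('y \<Rightarrow> 's) \<Rightarrow> ('x \<Rightarrow> 's)" where
  "pullback h c = c \<circ> h"

definition pre_cellular_morphism ::
  "'m set \<Rightarrow> ('m, 's, 'x) coalg \<Rightarrow> ('m, 's, 'y) coalg \<Rightarrow> ('x \<Rightarrow> 'y) \<Rightarrow> bool" where
  "pre_cellular_morphism N \<gamma> \<delta> h \<longleftrightarrow> C_map N h \<circ> \<gamma> = \<delta> \<circ> h"

definition cellular_morphism ::
  "'m set \<Rightarrow> ('m, 's, 'x) coalg \<Rightarrow> ('m, 's, 'y) coalg \<Rightarrow>
   ('x \<Rightarrow> 'y) \<times> (('x \<Rightarrow> 's) \<Rightarrow> ('y \<Rightarrow> 's)) \<Rightarrow> bool" where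
  "cellular_morphism N \<gamma> \<delta> = (\<lambda>(f, s). pre_cellular_morphism N \<gamma> \<delta> f \<and> pullback f \<circ> s = id)"

definition based_cellular_morphism ::
  "'m set \<Rightarrow> ('m, 's, 'x) coalg \<times> 'x \<Rightarrow> ('m, 's, 'y) coalg \<times> 'y \<Rightarrow>
   ('x \<Rightarrow> 'y) \<times> (('x \<Rightarrow> 's) \<Rightarrow> ('y \<Rightarrow> 's)) \<Rightarrow> bool" where
  "based_cellular_morphism N = (\<lambda>(\<gamma>, x\<^sub>0) (\<delta>, y\<^sub>0) (f, s).
     cellular_morphism N \<gamma> \<delta> (f, s) \<and> f x\<^sub>0 = y\<^sub>0)"

text \<open>
  In \<open>Disj J \<Phi>\<close> the index set \<open>J\<close> is any subset, possibly empty, of the type \<open>'j\<close>; values of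
  \<open>\<Phi>\<close> outside of \<open>J\<close> are irrelevant. No single HOL type contains the disjunctions over all index
  sets, so \<open>'j\<close> is a parameter, kept as an unconstrained type variable in statements about
  formulas.
\<close>

datatype ('m, 's, 'j) formula =
    State 's
  | Neg "('m, 's, 'j) formula"
  | Disj "'j set" "'j \<Rightarrow> ('m, 's, 'j) formula"
  | Diamond 'm "('m, 's, 'j) formula"
  | Next "('m, 's, 'j) formula"

primrec satisfies ::
  "'m set \<Rightarrow> ('m, 's, 'x) coalg \<Rightarrow> 'x \<Rightarrow> ('x \<Rightarrow> 's) \<Rightarrow> ('m, 's, 'j) formula \<Rightarrow> bool"
where
  "satisfies N \<gamma> x c (State s) \<longleftrightarrow> c x = s"
| "satisfies N \<gamma> x c (Neg \<phi>) \<longleftrightarrow> \<not> satisfies N \<gamma> x c \<phi>"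
| "satisfies N \<gamma> x c (Disj J \<Phi>) \<longleftrightarrow> (\<exists>j\<in>J. satisfies N \<gamma> x c (\<Phi> j))"
| "satisfies N \<gamma> x c (Diamond m \<phi>) \<longleftrightarrow> satisfies N \<gamma> (action \<gamma> x m) c \<phi>"
| "satisfies N \<gamma> x c (Next \<phi>) \<longleftrightarrow> satisfies N \<gamma> x (global_rule N \<gamma> c) \<phi>"

text \<open>
  The argument \<open>TYPE('j)\<close> selects the type of disjunction indices. A map that preserves and reflects
  formulas with arbitrary disjunctions is a logical transport for every \<open>'j\<close>, so a theorem assuming
  this property for an unconstrained \<open>'j\<close> covers arbitrary index sets.
\<close>

definition logical_transport ::
  "'j itself \<Rightarrow> 'm set \<Rightarrow> ('m, 's, 'x) coalg \<times> 'x \<Rightarrow> ('m, 's, 'y) coalg \<times> 'y \<Rightarrow>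
   (('x \<Rightarrow> 's) \<Rightarrow> ('y \<Rightarrow> 's)) \<Rightarrow> bool" where
  "logical_transport _ N = (\<lambda>(\<gamma>, x\<^sub>0) (\<delta>, y\<^sub>0) t.
     \<forall>(\<phi> :: ('m, 's, 'j) formula) c. satisfies N \<gamma> x\<^sub>0 c \<phi> \<longleftrightarrow> satisfies N \<delta> y\<^sub>0 (t c) \<phi>)"

end

theory Submission
  imports Defs
begin

text \<open>
  Since \<open>\<gamma>\<close> is reachable and free, \<open>m \<mapsto> x\<^sub>0 m\<close> is a bijection from the monoid to the cells, so the
  only candidate, \<open>x\<^sub>0 m \<mapsto> y\<^sub>0 m\<close>, is well defined and equivariant. The formulas \<open>\<langle>m\<rangle>s\<close> give
  \<open>t c \<circ> f = c\<close>, and the formulas \<open>\<langle>m\<rangle>\<circle>s\<close> give equality of the local rules, because by freeness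
  every pattern around a cell \<open>x\<close> is induced by some configuration.
\<close>

lemma pre_cellular_morphism_action:
  assumes "pre_cellular_morphism N \<gamma> \<delta> h"
  shows "h \<circ> action \<gamma> x = action \<delta> (h x)"
proof -
  have "C_map N h (\<gamma> x) = \<delta> (h x)"
    using assms by (simp add: pre_cellular_morphism_def fun_eq_iff)
  from arg_cong[OF this, of fst] show ?thesis
    by (simp add: C_map_def action_def split_beta)
qed

text \<open>This splits the coalgebra square into its two components. The assumption on
  \<open>\<delta>\<close> serves the converse direction: agreement of the local rules on patterns
  determines them as HOL functions only if \<open>local_rule \<delta> (h x)\<close> is
  \<open>undefined\<close> elsewhere.\<close>

lemma pre_cellular_morphism_iff:
  assumes "\<And>y. \<delta> y \<in> C_obj N"
  shows "pre_cellular_morphism N \<gamma> \<delta> h \<longleftrightarrow>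
    (\<forall>x m. h (action \<gamma> x m) = action \<delta> (h x) m) \<and>
    (\<forall>x. \<forall>p\<in>patterns N (action \<delta> (h x)). local_rule \<delta> (h x) p = local_rule \<gamma> x p)"
    (is "_ \<longleftrightarrow> ?equivariant \<and> ?local")
proof
  assume h: "pre_cellular_morphism N \<gamma> \<delta> h"
  then have eq: "C_map N h (\<gamma> x) = \<delta> (h x)" for x
    by (simp add: pre_cellular_morphism_def fun_eq_iff)
  have local: "local_rule \<delta> (h x) = restrict (local_rule \<gamma> x) (patterns N (h \<circ> action \<gamma> x))" for x
    using arg_cong[OF eq[of x], of snd] by (simp add: C_map_def action_def local_rule_def split_beta)
  show "?equivariant \<and> ?local"
    by (simp add: local flip: pre_cellular_morphism_action[OF h])
next
  assume asm: "?equivariant \<and> ?local"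
  have "C_map N h (\<gamma> x) = \<delta> (h x)" for x
  proof (rule prod_eqI)
    have act: "h \<circ> action \<gamma> x = action \<delta> (h x)"
      using asm by auto
    then show "fst (C_map N h (\<gamma> x)) = fst (\<delta> (h x))"
      by (simp add: C_map_def action_def split_beta)
    have "local_rule \<delta> (h x) \<in> patterns N (action \<delta> (h x)) \<rightarrow>\<^sub>E UNIV"
      using assms[of "h x"] by (auto simp: C_obj_def action_def local_rule_def)
    then have "restrict (local_rule \<gamma> x) (patterns N (action \<delta> (h x))) = local_rule \<delta> (h x)"
      using asm by (intro extensionalityI[of _ "patterns N (action \<delta> (h x))"]) (auto simp: PiE_def)
    then show "snd (C_map N h (\<gamma> x)) = snd (\<delta> (h x))"
      using act by (simp add: C_map_def action_def local_rule_def split_beta)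
  qed
  then show "pre_cellular_morphism N \<gamma> \<delta> h"
    unfolding pre_cellular_morphism_def by auto
qed

lemma logical_transport_config:
  fixes \<gamma> :: "('m, 's, 'x) coalg"
  assumes "logical_transport TYPE('j) N (\<gamma>, x\<^sub>0) (\<delta>, y\<^sub>0) t"
  shows "t c (action \<delta> y\<^sub>0 m) = c (action \<gamma> x\<^sub>0 m)"
proof -
  define \<phi> :: "('m, 's, 'j) formula" where "\<phi> = Diamond m (State (c (action \<gamma> x\<^sub>0 m)))"
  have "satisfies N \<gamma> x\<^sub>0 c \<phi> \<longleftrightarrow> satisfies N \<delta> y\<^sub>0 (t c) \<phi>"
    using assms unfolding logical_transport_def by simp
  then show ?thesis
    by (simp add: \<phi>_def)
qed

text \<open>\<open>Diamond m\<close> moves to the cell reached by \<open>m\<close>, and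
  \<open>Next (State s)\<close> then compares \<open>s\<close> with the value of the global rule
  there. With \<open>s\<close> chosen as the value in \<open>\<gamma>\<close>, the formula holds in
  \<open>\<gamma>\<close>, so it holds in \<open>\<delta>\<close>.\<close>

lemma logical_transport_global_rule:
  fixes \<gamma> :: "('m, 's, 'x) coalg"
  assumes "logical_transport TYPE('j) N (\<gamma>, x\<^sub>0) (\<delta>, y\<^sub>0) t"
  shows "global_rule N \<delta> (t c) (action \<delta> y\<^sub>0 m) = global_rule N \<gamma> c (action \<gamma> x\<^sub>0 m)"
proof -
  define \<phi> :: "('m, 's, 'j) formula"
    where "\<phi> = Diamond m (Next (State (global_rule N \<gamma> c (action \<gamma> x\<^sub>0 m))))"
  have "satisfies N \<gamma> x\<^sub>0 c \<phi> \<longleftrightarrow> satisfies N \<delta> y\<^sub>0 (t c) \<phi>"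
    using assms unfolding logical_transport_def by simp
  then show ?thesis
    by (simp add: \<phi>_def)
qed

text \<open>By injectivity distinct elements of \<open>N\<close> reach distinct cells, so their
  states can be prescribed independently. The map \<open>a\<close> is unrelated to
  \<open>\<gamma>\<close>, since the patterns to be realised come from
  \<open>\<delta>\<close>.\<close>

lemma free_action_pattern_induced:
  assumes "free_action \<gamma>" and "p \<in> patterns N a"
  obtains c where "restrict (c \<circ> action \<gamma> x) N = p"
proof
  have extensional: "p \<in> extensional N"
    using assms(2) unfolding patterns_def PiE_def by blast
  have "inj (action \<gamma> x)"
    using assms(1) by (simp add: free_action_def)
  \<comment> \<open>The witness transports \<open>p\<close> along the action. Its values at cells
    that are not of the form \<open>action \<gamma> x m\<close> are arbitrary and never read;
    outside of \<open>N\<close> both sides are \<open>undefined\<close>.\<close>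
  then show "restrict (p \<circ> inv (action \<gamma> x) \<circ> action \<gamma> x) N = p"
    using extensional by (simp add: extensional_restrict)
qed

text \<open>Every cell is reached from \<open>x\<^sub>0\<close>, so equivariance determines the map
  from its value at \<open>x\<^sub>0\<close>.\<close>

lemma based_pre_cellular_morphism_unique:
  assumes "reachable \<gamma> x\<^sub>0"
    and "pre_cellular_morphism N \<gamma> \<delta> f" and "pre_cellular_morphism N \<gamma> \<delta> g"
    and "f x\<^sub>0 = g x\<^sub>0"
  shows "f = g"
proof
  fix x
  obtain m where "x = action \<gamma> x\<^sub>0 m"
    using assms(1) unfolding reachable_def by (rule surjE)
  then show "f x = g x"
    using assms(2-4) by (metis comp_apply pre_cellular_morphism_action)
qed

theorem theorem3:
  fixes N :: "'m::monoid_mult set"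
    and \<gamma> :: "('m, 's, 'x) coalg" and x\<^sub>0 :: 'x
    and \<delta> :: "('m, 's, 'y) coalg" and y\<^sub>0 :: 'y
    and t :: "('x \<Rightarrow> 's) \<Rightarrow> ('y \<Rightarrow> 's)"
  assumes "cellular_automaton N \<gamma>" and "cellular_automaton N \<delta>"
    and "reachable \<gamma> x\<^sub>0" and "reachable \<delta> y\<^sub>0"
    and "free_action \<gamma>"
    and "logical_transport TYPE('j) N (\<gamma>, x\<^sub>0) (\<delta>, y\<^sub>0) t"
  shows "\<exists>!f. based_cellular_morphism N (\<gamma>, x\<^sub>0) (\<delta>, y\<^sub>0) (f, t)"
proof -
  have \<delta>_obj: "\<delta> y \<in> C_obj N" for y
    using assms(2) by (simp add: cellular_automaton_def)
  have \<gamma>_act: "action \<gamma> x 1 = x" "action \<gamma> (action \<gamma> x m) n = action \<gamma> x (n * m)" for x m n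
    using assms(1) by (auto simp: cellular_automaton_def)
  have \<delta>_act: "action \<delta> y 1 = y" "action \<delta> (action \<delta> y m) n = action \<delta> y (n * m)" for y m n
    using assms(2) by (auto simp: cellular_automaton_def)
  have x_cases: "\<exists>m. x = action \<gamma> x\<^sub>0 m" for x
    using assms(3) unfolding reachable_def by (rule surjD)
  define f where "f = action \<delta> y\<^sub>0 \<circ> inv (action \<gamma> x\<^sub>0)"
  have f: "f (action \<gamma> x\<^sub>0 m) = action \<delta> y\<^sub>0 m" for m
    using assms(5) by (simp add: f_def free_action_def)
  \<comment> \<open>For \<open>x = action \<gamma> x\<^sub>0 m\<close> both sides equal
    \<open>action \<delta> y\<^sub>0 (n * m)\<close>.\<close>
  have equivariant: "f (action \<gamma> x n) = action \<delta> (f x) n" for x n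
    using x_cases[of x] by (auto simp: f \<gamma>_act \<delta>_act)
  have t_f: "t c (f x) = c x" for c x
    using x_cases[of x] by (auto simp: f logical_transport_config[OF assms(6)])
  have global: "global_rule N \<delta> (t c) (f x) = global_rule N \<gamma> c x" for c x
    using x_cases[of x] by (auto simp: f logical_transport_global_rule[OF assms(6)])
  have "local_rule \<delta> (f x) p = local_rule \<gamma> x p"
    if p: "p \<in> patterns N (action \<delta> (f x))" for x p
  proof -
    obtain c where c: "restrict (c \<circ> action \<gamma> x) N = p"
      using free_action_pattern_induced[OF assms(5) p] .
    \<comment> \<open>Around \<open>f x\<close> the configuration \<open>t c\<close> shows the same
      states as \<open>c\<close> around \<open>x\<close>, namely \<open>p\<close> on
      \<open>N\<close>. Hence both sides of \<open>global\<close> are local rules evaluated at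
      \<open>p\<close>.\<close>
    have "t c \<circ> action \<delta> (f x) = c \<circ> action \<gamma> x"
      by (auto simp: t_f simp flip: equivariant)
    then show ?thesis
      using global[of c x] c by (simp add: global_rule_def)
  qed
  then have "pre_cellular_morphism N \<gamma> \<delta> f"
    using equivariant by (simp add: pre_cellular_morphism_iff[OF \<delta>_obj])
  moreover have "pullback f \<circ> t = id"
    by (simp add: fun_eq_iff pullback_def t_f)
  moreover have "f x\<^sub>0 = y\<^sub>0"
    using f[of 1] by (simp add: \<gamma>_act \<delta>_act)
  ultimately have morphism: "based_cellular_morphism N (\<gamma>, x\<^sub>0) (\<delta>, y\<^sub>0) (f, t)"
    by (simp add: based_cellular_morphism_def cellular_morphism_def)
  show ?thesis
  proof (intro ex1I[of _ f] morphism)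
    fix g
    assume "based_cellular_morphism N (\<gamma>, x\<^sub>0) (\<delta>, y\<^sub>0) (g, t)"
    then have "pre_cellular_morphism N \<gamma> \<delta> g" and "g x\<^sub>0 = f x\<^sub>0"
      by (simp_all add: \<open>f x\<^sub>0 = y\<^sub>0\<close> based_cellular_morphism_def cellular_morphism_def)
    then show "g = f"
      using based_pre_cellular_morphism_unique[OF assms(3)] \<open>pre_cellular_morphism N \<gamma> \<delta> f\<close> by blast
  qed
qed

end
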